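(* For each integer $k\ge 1$, the diagonal $D_k$ of the Pascal rhombus (mod 2), consisting of the cells $[n,-n+k+1]$ for integers $n\ge (k+1)/2$, is periodic with period length $2^p$, where $p=\lceil \log_2(k)\rceil+1$; that is, $R[n+2^p,\,-(n+2^p)+k+1]\equiv R[n,\,-n+k+1]\pmod 2$ for all integers $n\ge (k+1)/2$. Moreover, the diagonal $D_0$, consisting of the cells $[n,-n+1]$ for integers $n\ge 1$, has period 1 modulo 2.
   Context: The Pascal rhombus is the array of integers $R[n,k]$ ($n\ge 0$ an integer row index, $k\in\mathbb{Z}$ a column index) defined by $R[0,j]=0$ for all $j$, $R[1,0]=1$, $R[1,j]=0$ for $j\neq 0$, and $R[n,k]=R[n-1,k-1]+R[n-1,k]+R[n-1,k+1]+R[n-2,k]$ for $n\ge 2$ and all $k$. The notation $[n,k]$ denotes the cell in row $n$, column $k$. The Pascal rhombus (mod 2) is the array of the entries $R[n,k]$ reduced modulo 2. The period lengths asserted are not claimed to be minimal. *)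

theory Defs
  imports Complex_Main "HOL-Number_Theory.Cong"
begin

fun pascal_rhombus :: "nat \<Rightarrow> int \<Rightarrow> int" where
  "pascal_rhombus 0 j = 0"
| "pascal_rhombus (Suc 0) j = (if j = 0 then 1 else 0)"
| "pascal_rhombus (Suc (Suc n)) j =
     pascal_rhombus (Suc n) (j - 1) + pascal_rhombus (Suc n) j
     + pascal_rhombus (Suc n) (j + 1) + pascal_rhombus n j"

end

(* Writing d_k(n) for the entry of D_k in row n and D for the operator f(n) + f(n+1), the recurrence
   reads D d_k (n+1) = d_{k-1}(n+1) + D d_{k-2} (n) modulo 2. Hence the power k+1 of D annihilates
   d_k modulo 2 on the stated range of rows. Since (1 + E)^(2^p) = 1 + E^(2^p) modulo 2 for the
   shift E, the diagonal has period 2^p as soon as 2^p > k. *)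

theory Submission
  imports Defs
begin

definition shift_sum :: "(nat \<Rightarrow> int) \<Rightarrow> nat \<Rightarrow> int" where
  "shift_sum f n = f n + f (n + 1)"

lemma shift_sum_funpow_add:
  "(shift_sum ^^ m) (\<lambda>n. f n + g n) n = (shift_sum ^^ m) f n + (shift_sum ^^ m) g n"
  by (induction m arbitrary: n) (auto simp: shift_sum_def)

lemma shift_sum_funpow_Suc_arg:
  "(shift_sum ^^ m) (\<lambda>n. f (Suc n)) n = (shift_sum ^^ m) f (Suc n)"
  by (induction m arbitrary: n) (auto simp: shift_sum_def)

text \<open>Squaring 1 + E^(2^p) leaves the cross term 2 E^(2^p), which vanishes modulo 2. The
  induction keeps \<open>f\<close> arbitrary because the hypothesis is applied both to
  \<open>f\<close> and to its image \<open>?g\<close>.\<close>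

lemma shift_sum_funpow_pow2:
  "[(shift_sum ^^ (2 ^ p)) f n = f n + f (n + 2 ^ p)] (mod 2)"
proof (induction p arbitrary: f n)
  case 0
  then show ?case by (simp add: shift_sum_def)
next
  case (Suc p)
  let ?g = "(shift_sum ^^ (2 ^ p)) f"
  have "(shift_sum ^^ (2 ^ Suc p)) f n = (shift_sum ^^ (2 ^ p)) ?g n"
    by (simp only: power_Suc mult_2 funpow_add comp_apply)
  also have "[\<dots> = ?g n + ?g (n + 2 ^ p)] (mod 2)"
    by (rule Suc.IH)
  also have "[?g n + ?g (n + 2 ^ p) =
      (f n + f (n + 2 ^ p)) + (f (n + 2 ^ p) + f (n + 2 ^ p + 2 ^ p))] (mod 2)"
    by (intro cong_add Suc.IH)
  also have "[(f n + f (n + 2 ^ p)) + (f (n + 2 ^ p) + f (n + 2 ^ p + 2 ^ p)) =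
      f n + f (n + 2 ^ Suc p)] (mod 2)"
    by (simp add: cong_iff_dvd_diff add.assoc flip: mult_2)
  finally show ?case .
qed

text \<open>An integer index lets the recurrence descend to \<open>k - 1\<close> and
  \<open>k - 2\<close> without truncation; it ends on the negative diagonals, which lie outside the
  triangle of nonzero entries.\<close>

definition diagonal :: "int \<Rightarrow> nat \<Rightarrow> int" where
  "diagonal k n = pascal_rhombus n (- int n + k + 1)"

lemma pascal_rhombus_eq_0: "j \<le> - int n \<Longrightarrow> pascal_rhombus n j = 0"
  by (induction n j rule: pascal_rhombus.induct) auto

lemma diagonal_neg: "k < 0 \<Longrightarrow> diagonal k = (\<lambda>n. 0)"
  by (auto simp: diagonal_def pascal_rhombus_eq_0)

text \<open>The defining recurrence for row \<open>n + 2\<close>, with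
  \<open>diagonal k (Suc n)\<close> added to both sides; it holds exactly in the integers. The
  doubled term stays a sum so that \<open>shift_sum_funpow_add\<close> can split it.\<close>

lemma shift_sum_diagonal_Suc:
  "shift_sum (diagonal k) (Suc n) =
     (diagonal k (Suc n) + diagonal k (Suc n)) +
     (diagonal (k - 1) (Suc n) + shift_sum (diagonal (k - 2)) n)"
  by (simp add: shift_sum_def diagonal_def algebra_simps)

lemma shift_sum_funpow_zero: "(shift_sum ^^ m) (\<lambda>n. 0) n = 0"
  by (induction m arbitrary: n) (auto simp: shift_sum_def)

text \<open>Strong induction on the diagonal index, since the recurrence goes back by one and by
  two. Lowering \<open>k\<close> by 2 costs one row, which explains the factor 2 in the row
  bound.\<close>

lemma even_shift_sum_funpow_diagonal:
  assumes "k + 1 \<le> int m" "k + 1 \<le> 2 * int n"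
  shows "even ((shift_sum ^^ m) (diagonal k) n)"
  using assms
proof (induction "nat (k + 1)" arbitrary: k m n rule: less_induct)
  case less
  show ?case
  proof (cases "k < 0")
    case True
    then show ?thesis by (simp add: diagonal_neg shift_sum_funpow_zero)
  next
    case False
    \<comment> \<open>For \<open>k \<ge> 0\<close> both bounds force positive values, so one
      application of the operator can be peeled off and the recurrence used.\<close>
    with less.prems obtain m' n' where m: "m = Suc m'" and n: "n = Suc n'"
      by (cases m; cases n) auto
    let ?D = "shift_sum ^^ m'"
    have "(shift_sum ^^ m) (diagonal k) n = ?D (\<lambda>i. shift_sum (diagonal k) (Suc i)) n'"
      by (simp add: m n funpow_Suc_right shift_sum_funpow_Suc_arg del: funpow.simps)
    \<comment> \<open>The inner \<open>shift_sum\<close> on \<open>diagonal (k - 2)\<close> restores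
      the exponent \<open>m\<close>, while \<open>diagonal (k - 1)\<close> keeps only
      \<open>m'\<close>, still enough for its smaller index.\<close>
    also have "\<dots> = 2 * ?D (diagonal k) n +
        (?D (diagonal (k - 1)) n + (shift_sum ^^ m) (diagonal (k - 2)) n')"
      unfolding shift_sum_diagonal_Suc shift_sum_funpow_add shift_sum_funpow_Suc_arg
      by (simp add: m n funpow_Suc_right del: funpow.simps)
    finally have eq: "(shift_sum ^^ m) (diagonal k) n = 2 * ?D (diagonal k) n +
        (?D (diagonal (k - 1)) n + (shift_sum ^^ m) (diagonal (k - 2)) n')" .
    have "even (?D (diagonal (k - 1)) n)"
      using less.prems False m by (intro less.hyps) auto
    moreover have "even ((shift_sum ^^ m) (diagonal (k - 2)) n')"
      using less.prems False n by (intro less.hyps) auto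
    ultimately show ?thesis
      unfolding eq by simp
  qed
qed

lemma diagonal_period:
  assumes "k + 1 \<le> 2 ^ p" "k + 1 \<le> 2 * int n"
  shows "[diagonal k (n + 2 ^ p) = diagonal k n] (mod 2)"
proof -
  have "even ((shift_sum ^^ (2 ^ p)) (diagonal k) n)"
    using assms by (intro even_shift_sum_funpow_diagonal) auto
  then have "even (diagonal k n + diagonal k (n + 2 ^ p))"
    using shift_sum_funpow_pow2[of p "diagonal k" n] by (simp add: cong_dvd_iff)
  then show ?thesis
    by (simp add: cong_iff_dvd_diff)
qed

text \<open>The ceiling alone gives only k \<le> 2^c, which is one short when k is a power of 2. The
  extra 1 in the exponent doubles the bound, and 2k \<ge> k + 1.\<close>

lemma le_two_power_ceiling_log:
  assumes "k \<ge> 1"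
  shows "k + 1 \<le> 2 ^ nat (\<lceil>log 2 (real_of_int k)\<rceil> + 1)"
proof -
  define c where "c = nat \<lceil>log 2 (real_of_int k)\<rceil>"
  have nonneg: "0 \<le> log 2 (real_of_int k)"
    using assms by simp
  then have c: "nat (\<lceil>log 2 (real_of_int k)\<rceil> + 1) = Suc c"
    unfolding c_def by (simp add: nat_add_distrib)
  have "log 2 (real_of_int k) \<le> real c"
    unfolding c_def by (rule real_nat_ceiling_ge)
  then have "real_of_int k \<le> 2 powr real c"
    using assms by (simp add: log_le_iff)
  then have "real_of_int k \<le> real_of_int (2 ^ c)"
    by (simp add: powr_realpow)
  then have "k \<le> 2 ^ c"
    by (simp only: of_int_le_iff)
  then show ?thesis
    using assms by (simp add: c)
qed

theorem mainTheorem3: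
  shows "(\<forall>k::int. k \<ge> 1 \<longrightarrow>
            (let p = nat (\<lceil>log 2 (real_of_int k)\<rceil> + 1) in
              \<forall>n::nat. real n \<ge> (real_of_int k + 1) / 2 \<longrightarrow>
                [pascal_rhombus (n + 2 ^ p) (- int (n + 2 ^ p) + k + 1)
                   = pascal_rhombus n (- int n + k + 1)] (mod 2)))
       \<and> (\<forall>n::nat. n \<ge> 1 \<longrightarrow>
            [pascal_rhombus (n + 1) (- int (n + 1) + 1)
               = pascal_rhombus n (- int n + 1)] (mod 2))"
proof (unfold Let_def, intro conjI allI impI)
  fix k :: int and n :: nat
  assume "k \<ge> 1" and n: "(real_of_int k + 1) / 2 \<le> real n"
  from n have "real_of_int (k + 1) \<le> real_of_int (2 * int n)"
    by simp
  then have "k + 1 \<le> 2 * int n"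
    by (simp only: of_int_le_iff)
  with le_two_power_ceiling_log[OF \<open>k \<ge> 1\<close>]
  show "[pascal_rhombus (n + 2 ^ nat (\<lceil>log 2 (real_of_int k)\<rceil> + 1))
          (- int (n + 2 ^ nat (\<lceil>log 2 (real_of_int k)\<rceil> + 1)) + k + 1)
         = pascal_rhombus n (- int n + k + 1)] (mod 2)"
    using diagonal_period unfolding diagonal_def by blast
next
  fix n :: nat
  assume "n \<ge> 1"
  then show "[pascal_rhombus (n + 1) (- int (n + 1) + 1)
               = pascal_rhombus n (- int n + 1)] (mod 2)"
    \<comment> \<open>For \<open>k = 0\<close> the exponent \<open>p = 0\<close> already suffices,
      giving period 2^0 = 1.\<close>
    using diagonal_period[of 0 0 n] by (simp add: diagonal_def)
qed

end
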